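(* Let $(a,c)\in\mathbb R\times\mathbb R$, $f\in\mathcal S(\mathbb R)$, and for $k=0,1$ set $$F_k(f;s,a,c):=\Phi_k(f;s,a,c)+(-1)^k e^{-\pi i a}\Phi_k(\mathcal F f;1-s,1-c,a).$$ These are meromorphic functions of $s$ with the following properties. (i) $F_1(f;s,a,c)$ is an entire function of $s$ for all $(a,c)\in\mathbb R\times\mathbb R$. $F_0(f;s,a,c)$ is an entire function of $s$ when both $a$ and $c$ are non-integers; otherwise it is meromorphic with possible simple poles at $s=0,1$. A pole may occur at $s=0$ only if $c$ is an integer, and at $s=1$ only if $a$ is an integer, with residues $$\mathrm{Res}_{s=0}F_0(f;s,a,c)=-2e^{-\pi i ac}f(0)\ \text{ if } c\in\mathbb Z,\qquad \mathrm{Res}_{s=1}F_0(f;s,a,c)=2e^{\pi i ac}\mathcal F f(0)\ \text{ if } a\in\mathbb Z.$$ (ii) $F_k(f;s,a+1,c)=e^{\pi i c}F_k(f;s,a,c)$ and $F_k(f;s,a,c+1)=e^{-\pi i a}F_k(f;s,a,c)$. (iii) $F_k(f;s,a,c)=(-1)^k e^{-\pi i a}F_k(\mathcal F f;1-s,1-c,a)$.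
   Context: $\mathcal S(\mathbb R)$ is the Schwartz space and $\mathcal F f(y)=\int_{-\infty}^\infty e^{-2\pi i xy}f(x)\,dx$. Let $\delta_{\mathbb Z}(c)=1$ if $c\in\mathbb Z$ and $0$ otherwise. For $k\in\{0,1\}$, real $a,c$ and $s\in\mathbb C$, $$\Phi_k(f;s,a,c):=\int_1^\infty\Big(\sum_{n\in\mathbb Z,\,n\neq -c}e^{2\pi i a(n+\frac c2)}f((n+c)x)\Big)x^{s-1}dx$$ $$\quad+(-1)^k e^{-\pi i(a+1-c)}\int_1^\infty\Big(\sum_{m\in\mathbb Z,\,m\ne c-1}e^{2\pi i(1-a)(m+\frac{1-c}{2})}f((m+1-c)x)\Big)x^{s-1}dx-\delta_{\mathbb Z}(c)e^{-\pi i ac}(1+(-1)^k)f(0)\frac1s.$$ *)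

theory Defs
  imports "HOL-Complex_Analysis.Complex_Analysis"
begin

definition nth_vderiv :: "nat \<Rightarrow> (real \<Rightarrow> complex) \<Rightarrow> real \<Rightarrow> complex" where
  "nth_vderiv n f = ((\<lambda>g x. vector_derivative g (at x)) ^^ n) f"

definition schwartz :: "(real \<Rightarrow> complex) set" where
  "schwartz = {f. (\<forall>n x. nth_vderiv n f differentiable (at x)) \<and>
                  (\<forall>m n. bounded (range (\<lambda>x. x ^ m *\<^sub>R nth_vderiv n f x)))}"

definition fourier :: "(real \<Rightarrow> complex) \<Rightarrow> real \<Rightarrow> complex" where
  "fourier f y = (LBINT x. exp (- 2 * of_real pi * \<i> * of_real (x * y)) * f x)"

definition delta_Z :: "real \<Rightarrow> complex" where
  "delta_Z c = (if c \<in> \<int> then 1 else 0)"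

text \<open>
  At \<open>s = 0\<close> the last summand is \<open>0\<close> by the convention \<open>1 / 0 = 0\<close>; this value is immaterial
  whenever \<open>0\<close> is a pole, and is the correct one whenever the coefficient of \<open>1 / s\<close> vanishes.
\<close>

definition Phi :: "nat \<Rightarrow> (real \<Rightarrow> complex) \<Rightarrow> complex \<Rightarrow> real \<Rightarrow> real \<Rightarrow> complex" where
  "Phi k f s a c =
     (LBINT x:{1..}.
        (\<Sum>\<^sub>\<infinity>n\<in>{n::int. of_int n \<noteq> - c}.
           exp (2 * of_real pi * \<i> * of_real (a * (of_int n + c / 2))) * f ((of_int n + c) * x))
        * of_real x powr (s - 1))
   + (-1) ^ k * exp (- of_real pi * \<i> * of_real (a + 1 - c)) *
     (LBINT x:{1..}.
        (\<Sum>\<^sub>\<infinity>m\<in>{m::int. of_int m \<noteq> c - 1}.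
           exp (2 * of_real pi * \<i> * of_real ((1 - a) * (of_int m + (1 - c) / 2)))
           * f ((of_int m + 1 - c) * x))
        * of_real x powr (s - 1))
   - delta_Z c * exp (- of_real pi * \<i> * of_real (a * c)) * (1 + (-1) ^ k) * f 0 * (1 / s)"

definition Fk :: "nat \<Rightarrow> (real \<Rightarrow> complex) \<Rightarrow> complex \<Rightarrow> real \<Rightarrow> real \<Rightarrow> complex" where
  "Fk k f s a c =
     Phi k f s a c
     + (-1) ^ k * exp (- of_real pi * \<i> * of_real a) * Phi k (fourier f) (1 - s) (1 - c) a"

end

theory Submission
  imports Defs "HOL-Probability.Probability"
begin

text \<open>
  The substitution \<open>m = - n - 1\<close> turns the second integral of \<open>\<Phi>\<^sub>k\<close> into the first one with \<open>f\<close>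
  replaced by \<open>t \<mapsto> f (- t)\<close>; the exponential prefactor is exactly what the substitution absorbs.
  The quasi-periodicity relations are then index shifts, and the functional equation is this same
  reflection combined with the inversion formula \<open>\<F> (\<F> f) t = f (- t)\<close>, so no Poisson summation
  is needed. The analytic statement holds because the sums decay faster than any power of \<open>x\<close> on
  \<open>[1, \<infinity>)\<close>, so their Mellin integrals over that range are entire and only the explicit terms in
  \<open>1 / s\<close> and \<open>1 / (1 - s)\<close> can contribute poles.
\<close>

section \<open>Twisted lattice sums\<close>

definition cis_pi :: "real \<Rightarrow> complex" where
  "cis_pi t = cis (pi * t)"

lemma exp_eq_cis_pi:
  "exp (of_real pi * \<i> * of_real t) = cis_pi t"
  "exp (- of_real pi * \<i> * of_real t) = cis_pi (- t)"
  "exp (2 * of_real pi * \<i> * of_real t) = cis_pi (2 * t)"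
  "exp (- 2 * of_real pi * \<i> * of_real t) = cis_pi (- 2 * t)"
  by (simp_all add: cis_pi_def cis_conv_exp mult_ac)

lemma cis_pi_0 [simp]: "cis_pi 0 = 1"
  by (simp add: cis_pi_def)

lemma norm_cis_pi [simp]: "norm (cis_pi t) = 1"
  by (simp add: cis_pi_def)

lemma cis_pi_add: "cis_pi (s + t) = cis_pi s * cis_pi t"
  by (simp add: cis_pi_def cis_mult distrib_left)

lemma cis_pi_cong:
  assumes "s - t = 2 * of_int n"
  shows "cis_pi s = cis_pi t"
proof -
  have "cis_pi (2 * of_int n) = 1"
    using cis_multiple_2pi[of "of_int n"] by (simp add: cis_pi_def mult_ac)
  moreover have "s = t + 2 * of_int n"
    using assms by simp
  ultimately show ?thesis
    by (simp only: cis_pi_add mult_1_right)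
qed

text \<open>
  Summing over all integers with a weight \<open>h\<close> makes each symmetry a single statement: a weight vanishing
  at \<open>0\<close> gives the sums inside \<open>\<Phi>\<^sub>k\<close>, and \<open>indicator {0}\<close> gives the coefficient of the term
  \<open>n = - c\<close> that they omit, which reappears in front of \<open>1 / s\<close>.
\<close>

definition lattice_sum :: "real \<Rightarrow> real \<Rightarrow> (real \<Rightarrow> complex) \<Rightarrow> complex" where
  "lattice_sum a c h = (\<Sum>\<^sub>\<infinity>n::int. cis_pi (2 * (a * (of_int n + c / 2))) * h (of_int n + c))"

lemma lattice_sum_shift_left: "lattice_sum (a + 1) c h = cis_pi c * lattice_sum a c h"
proof -
  have "cis_pi (2 * ((a + 1) * (of_int n + c / 2))) = cis_pi c * cis_pi (2 * (a * (of_int n + c / 2)))" for n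
    unfolding cis_pi_add[symmetric] by (rule cis_pi_cong[where n = n]) (simp add: field_simps)
  then show ?thesis
    by (simp add: lattice_sum_def mult.assoc infsum_cmult_right')
qed

lemma lattice_sum_shift_right: "lattice_sum a (c + 1) h = cis_pi (- a) * lattice_sum a c h"
proof -
  have "bij (\<lambda>n::int. n - 1)"
    by (rule o_bij[where g = "\<lambda>n. n + 1"]) auto
  then have "lattice_sum a (c + 1) h =
      (\<Sum>\<^sub>\<infinity>n::int. cis_pi (2 * (a * (of_int (n - 1) + (c + 1) / 2))) * h (of_int (n - 1) + (c + 1)))"
    unfolding lattice_sum_def by (rule infsum_reindex_bij_betw[symmetric])
  also have "\<dots> = (\<Sum>\<^sub>\<infinity>n::int. cis_pi (- a) * (cis_pi (2 * (a * (of_int n + c / 2))) * h (of_int n + c)))"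
  proof (rule infsum_cong)
    fix n :: int
    have "2 * (a * (of_int (n - 1) + (c + 1) / 2)) = - a + 2 * (a * (of_int n + c / 2))"
      by (simp add: field_simps)
    then show "cis_pi (2 * (a * (of_int (n - 1) + (c + 1) / 2))) * h (of_int (n - 1) + (c + 1))
        = cis_pi (- a) * (cis_pi (2 * (a * (of_int n + c / 2))) * h (of_int n + c))"
      by (simp only: cis_pi_add) simp
  qed
  finally show ?thesis
    by (simp add: lattice_sum_def infsum_cmult_right')
qed

lemma lattice_sum_reflect:
  "cis_pi (- (a + 1 - c)) * lattice_sum (1 - a) (1 - c) h = lattice_sum a c (\<lambda>t. h (- t))"
proof -
  have "bij (\<lambda>n::int. - n - 1)"
    by (rule o_bij[where g = "\<lambda>n. - n - 1"]) auto
  then have "lattice_sum (1 - a) (1 - c) h =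
      (\<Sum>\<^sub>\<infinity>n::int. cis_pi (2 * ((1 - a) * (of_int (- n - 1) + (1 - c) / 2))) * h (of_int (- n - 1) + (1 - c)))"
    unfolding lattice_sum_def by (rule infsum_reindex_bij_betw[symmetric])
  also have "cis_pi (- (a + 1 - c)) * \<dots> = lattice_sum a c (\<lambda>t. h (- t))"
    unfolding lattice_sum_def infsum_cmult_right'[symmetric]
  proof (rule infsum_cong)
    fix n :: int
    have "cis_pi (- (a + 1 - c)) * cis_pi (2 * ((1 - a) * (of_int (- n - 1) + (1 - c) / 2)))
        = cis_pi (2 * (a * (of_int n + c / 2)))"
      unfolding cis_pi_add[symmetric]
      by (rule cis_pi_cong[where n = "- n - 1"]) (simp add: field_simps)
    moreover have "of_int (- n - 1) + (1 - c) = - (of_int n + c)"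
      by simp
    ultimately show "cis_pi (- (a + 1 - c)) *
          (cis_pi (2 * ((1 - a) * (of_int (- n - 1) + (1 - c) / 2))) * h (of_int (- n - 1) + (1 - c)))
        = cis_pi (2 * (a * (of_int n + c / 2))) * h (- (of_int n + c))"
      by (simp only: mult.assoc[symmetric])
  qed
  finally show ?thesis .
qed

lemma lattice_sum_punctured:
  "lattice_sum a c (h(0 := 0)) =
     (\<Sum>\<^sub>\<infinity>n\<in>{n::int. of_int n \<noteq> - c}. cis_pi (2 * (a * (of_int n + c / 2))) * h (of_int n + c))"
  unfolding lattice_sum_def by (rule infsum_cong_neutral) auto

lemma lattice_sum_indicator_0: "lattice_sum a c (indicator {0}) = delta_Z c * cis_pi (- (a * c))"
proof (cases "c \<in> \<int>")
  case True
  then obtain m where c_eq: "c = of_int m"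
    by (auto elim: Ints_cases)
  have "lattice_sum a c (indicator {0}) =
      (\<Sum>\<^sub>\<infinity>n\<in>{- m}. cis_pi (2 * (a * (of_int n + c / 2))) * indicator {0} (of_int n + c))"
    unfolding lattice_sum_def by (rule infsum_cong_neutral) (auto simp: c_eq indicator_def)
  then show ?thesis
    using True by (simp add: c_eq delta_Z_def)
next
  case False
  have "of_int n + c \<noteq> 0" for n
  proof
    assume "of_int n + c = 0"
    then have "c = of_int (- n)"
      by simp
    with False show False
      by simp
  qed
  with False show ?thesis
    by (simp add: lattice_sum_def delta_Z_def)
qed

section \<open>Symmetries of \<open>\<Phi>\<^sub>k\<close> and \<open>F\<^sub>k\<close>\<close>

definition punctured_sum :: "real \<Rightarrow> real \<Rightarrow> (real \<Rightarrow> complex) \<Rightarrow> real \<Rightarrow> complex" where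
  "punctured_sum a c g x = lattice_sum a c ((\<lambda>t. g (t * x))(0 := 0))"

lemma punctured_sum_shift_left: "punctured_sum (a + 1) c g = (\<lambda>x. cis_pi c * punctured_sum a c g x)"
  by (simp add: punctured_sum_def fun_eq_iff lattice_sum_shift_left)

lemma punctured_sum_shift_right: "punctured_sum a (c + 1) g = (\<lambda>x. cis_pi (- a) * punctured_sum a c g x)"
  by (simp add: punctured_sum_def fun_eq_iff lattice_sum_shift_right)

lemma punctured_sum_reflect:
  "punctured_sum a c (\<lambda>t. g (- t)) = (\<lambda>x. cis_pi (- (a + 1 - c)) * punctured_sum (1 - a) (1 - c) g x)"
proof -
  have "(\<lambda>t. g (- (t * x)))(0 := 0) = (\<lambda>t. ((\<lambda>t. g (t * x))(0 := 0)) (- t))" for x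
    by auto
  then show ?thesis
    unfolding punctured_sum_def lattice_sum_reflect by simp
qed

definition mellin_tail :: "(real \<Rightarrow> complex) \<Rightarrow> complex \<Rightarrow> complex" where
  "mellin_tail S s = (LBINT x:{1..}. S x * of_real x powr (s - 1))"

lemma mellin_tail_cmult: "mellin_tail (\<lambda>x. r * S x) s = r * mellin_tail S s"
  by (simp add: mellin_tail_def mult.assoc)

definition Phi_entire :: "nat \<Rightarrow> (real \<Rightarrow> complex) \<Rightarrow> complex \<Rightarrow> real \<Rightarrow> real \<Rightarrow> complex" where
  "Phi_entire k f s a c =
     mellin_tail (punctured_sum a c f) s + (-1) ^ k * mellin_tail (punctured_sum a c (\<lambda>t. f (- t))) s"

lemma Phi_eq:
  "Phi k f s a c = Phi_entire k f s a c - (1 + (-1) ^ k) * f 0 * lattice_sum a c (indicator {0}) / s"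
proof -
  have "(\<Sum>\<^sub>\<infinity>m\<in>{m::int. of_int m \<noteq> c - 1}.
        cis_pi (2 * ((1 - a) * (of_int m + (1 - c) / 2))) * f ((of_int m + 1 - c) * x))
      = punctured_sum (1 - a) (1 - c) f x" for x
    by (simp add: punctured_sum_def lattice_sum_punctured add_diff_eq)
  moreover have "(\<Sum>\<^sub>\<infinity>n\<in>{n::int. of_int n \<noteq> - c}. cis_pi (2 * (a * (of_int n + c / 2))) * f ((of_int n + c) * x))
      = punctured_sum a c f x" for x
    by (simp add: punctured_sum_def lattice_sum_punctured)
  ultimately show ?thesis
    unfolding Phi_def Phi_entire_def exp_eq_cis_pi punctured_sum_reflect mellin_tail_cmult
      lattice_sum_indicator_0
    by (simp add: mellin_tail_def mult_ac)
qed

lemma Phi_shift_left: "Phi k f s (a + 1) c = cis_pi c * Phi k f s a c"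
  unfolding Phi_eq Phi_entire_def punctured_sum_shift_left lattice_sum_shift_left mellin_tail_cmult
  by (simp add: algebra_simps)

lemma Phi_shift_right: "Phi k f s a (c + 1) = cis_pi (- a) * Phi k f s a c"
  unfolding Phi_eq Phi_entire_def punctured_sum_shift_right lattice_sum_shift_right mellin_tail_cmult
  by (simp add: algebra_simps)

lemma Phi_reflect: "cis_pi (- (a + 1 - c)) * Phi k (\<lambda>t. f (- t)) s (1 - a) (1 - c) = Phi k f s a c"
proof -
  let ?\<epsilon> = "cis_pi (- (a + 1 - c))"
  have mellin: "?\<epsilon> * mellin_tail (punctured_sum (1 - a) (1 - c) g) s
      = mellin_tail (punctured_sum a c (\<lambda>t. g (- t))) s" for g
    by (simp only: punctured_sum_reflect mellin_tail_cmult)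
  have entire: "?\<epsilon> * Phi_entire k (\<lambda>t. f (- t)) s (1 - a) (1 - c) = Phi_entire k f s a c"
    unfolding Phi_entire_def distrib_left mult.left_commute[of ?\<epsilon>] mellin by simp
  have "(\<lambda>t. indicator {0} (- t)) = (indicator {0} :: real \<Rightarrow> complex)"
    by (auto simp: indicator_def)
  then have polar: "?\<epsilon> * lattice_sum (1 - a) (1 - c) (indicator {0}) = lattice_sum a c (indicator {0})"
    by (simp only: lattice_sum_reflect)
  show ?thesis
    unfolding Phi_eq entire[symmetric] polar[symmetric] by (simp add: algebra_simps)
qed

lemma Fk_eq: "Fk k f s a c = Phi k f s a c + (-1) ^ k * cis_pi (- a) * Phi k (fourier f) (1 - s) (1 - c) a"
  by (simp only: Fk_def exp_eq_cis_pi)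

lemma Fk_shift_left: "Fk k f s (a + 1) c = cis_pi c * Fk k f s a c"
proof -
  have "cis_pi (- (a + 1)) * cis_pi (- (1 - c)) = cis_pi c * cis_pi (- a)"
    unfolding cis_pi_add[symmetric] by (rule cis_pi_cong[where n = "- 1"]) simp
  then have twist: "cis_pi (- (a + 1)) * (cis_pi (- (1 - c)) * z) = cis_pi c * (cis_pi (- a) * z)" for z
    by (simp only: mult.assoc[symmetric])
  show ?thesis
    unfolding Fk_eq Phi_shift_left Phi_shift_right mult.assoc twist by (simp add: algebra_simps)
qed

lemma Fk_shift_right: "Fk k f s a (c + 1) = cis_pi (- a) * Fk k f s a c"
proof -
  let ?\<Phi> = "Phi k (fourier f) (1 - s)"
  have "cis_pi (- a) * cis_pi a = 1"
    by (simp flip: cis_pi_add)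
  moreover have "?\<Phi> (1 - c) a = cis_pi a * ?\<Phi> (1 - (c + 1)) a"
    using Phi_shift_left[of k "fourier f" "1 - s" "- c" a] by (simp add: add.commute)
  ultimately have "cis_pi (- a) * ?\<Phi> (1 - c) a = ?\<Phi> (1 - (c + 1)) a"
    by (simp flip: mult.assoc)
  then show ?thesis
    unfolding Fk_eq Phi_shift_right by (simp add: distrib_left mult.left_commute mult.assoc)
qed

lemma Fk_functional_equation:
  assumes "fourier (fourier f) = (\<lambda>t. f (- t))"
  shows "Fk k f s a c = (-1) ^ k * cis_pi (- a) * Fk k (fourier f) (1 - s) (1 - c) a"
proof -
  have "cis_pi (- (a + 1 - c)) = cis_pi (- a) * cis_pi (- (1 - c))"
    by (simp add: algebra_simps flip: cis_pi_add)
  then have "Phi k f s a c = cis_pi (- a) * (cis_pi (- (1 - c)) * Phi k (\<lambda>t. f (- t)) s (1 - a) (1 - c))"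
    using Phi_reflect[of a c k f s] by (simp only: mult.assoc)
  moreover have "(-1) ^ k * (-1) ^ k = (1 :: complex)"
    by (simp flip: power_mult_distrib)
  ultimately show ?thesis
    by (simp add: Fk_eq assms algebra_simps)
qed

section \<open>Rapidly decreasing functions\<close>

definition rapidly_decreasing :: "(real \<Rightarrow> complex) \<Rightarrow> bool" where
  "rapidly_decreasing g \<longleftrightarrow>
     g \<in> borel_measurable borel \<and> (\<forall>m. \<exists>C. \<forall>x. \<bar>x\<bar> ^ m * norm (g x) \<le> C)"

lemma rapidly_decreasing_measurable: "rapidly_decreasing g \<Longrightarrow> g \<in> borel_measurable borel"
  by (simp add: rapidly_decreasing_def)

lemma rapidly_decreasing_bound:
  assumes "rapidly_decreasing g"
  obtains C where "C \<ge> 0" "\<And>x. \<bar>x\<bar> ^ m * norm (g x) \<le> C"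
proof -
  obtain C where decay: "\<And>x. \<bar>x\<bar> ^ m * norm (g x) \<le> C"
    using assms unfolding rapidly_decreasing_def by blast
  have "0 \<le> \<bar>0\<bar> ^ m * norm (g 0)"
    by simp
  also have "\<dots> \<le> C"
    by (rule decay)
  finally show thesis
    using decay by (rule that)
qed

lemma rapidly_decreasing_reflect:
  assumes "rapidly_decreasing g"
  shows "rapidly_decreasing (\<lambda>x. g (- x))"
  unfolding rapidly_decreasing_def
proof (intro conjI allI)
  note [measurable] = rapidly_decreasing_measurable[OF assms]
  show "(\<lambda>x. g (- x)) \<in> borel_measurable borel"
    by measurable
  fix m
  obtain C where "\<And>x. \<bar>x\<bar> ^ m * norm (g x) \<le> C"
    using rapidly_decreasing_bound[OF assms] by blast
  then show "\<exists>C. \<forall>x. \<bar>x\<bar> ^ m * norm (g (- x)) \<le> C"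
    by (metis abs_minus_cancel)
qed

lemma rapidly_decreasing_power_mult:
  assumes "rapidly_decreasing g"
  shows "rapidly_decreasing (\<lambda>x. of_real x ^ n * g x)"
  unfolding rapidly_decreasing_def
proof (intro conjI allI)
  note [measurable] = rapidly_decreasing_measurable[OF assms]
  show "(\<lambda>x. of_real x ^ n * g x) \<in> borel_measurable borel"
    by measurable
  fix m
  obtain C where "\<And>x. \<bar>x\<bar> ^ (m + n) * norm (g x) \<le> C"
    using rapidly_decreasing_bound[OF assms] by blast
  then show "\<exists>C. \<forall>x. \<bar>x\<bar> ^ m * norm (of_real x ^ n * g x) \<le> C"
    by (auto simp: norm_mult norm_power power_add mult.assoc)
qed

lemma rapidly_decreasing_integrable:
  assumes "rapidly_decreasing g"
  shows "integrable lborel g"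
proof -
  obtain B where bounded: "\<And>x. \<bar>x\<bar> ^ 0 * norm (g x) \<le> B"
    using rapidly_decreasing_bound[OF assms] by blast
  obtain C where square_decay: "\<And>x. \<bar>x\<bar> ^ 2 * norm (g x) \<le> C"
    using rapidly_decreasing_bound[OF assms] by blast
  have "norm (g x) \<le> (B + C) / (1 + x\<^sup>2)" for x
    using bounded[of x] square_decay[of x] by (simp add: pos_le_divide_eq add_pos_nonneg algebra_simps)
  then have "norm (g x) \<le> norm ((B + C) * inverse (1 + x\<^sup>2))" for x
    unfolding real_norm_def divide_inverse by (rule order_trans[OF _ abs_ge_self])
  moreover have "integrable lborel (\<lambda>x::real. (B + C) * inverse (1 + x\<^sup>2))"
    using integrable_inverse_1_plus_square by (simp add: set_integrable_def)
  ultimately show ?thesis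
    using rapidly_decreasing_measurable[OF assms]
    by (auto intro: Bochner_Integration.integrable_bound[where f = "\<lambda>x. (B + C) * inverse (1 + x\<^sup>2)"])
qed

lemma rapidly_decreasing_tendsto_0:
  assumes "rapidly_decreasing g"
  shows "(g \<longlongrightarrow> 0) at_infinity"
proof -
  obtain C where decay: "\<And>x. \<bar>x\<bar> ^ 1 * norm (g x) \<le> C"
    using rapidly_decreasing_bound[OF assms] by blast
  have "norm (g x) \<le> C * norm (inverse x)" if "x \<noteq> 0" for x
    using decay[of x] that by (simp add: field_simps)
  then have "\<forall>\<^sub>F x in at_infinity. norm (g x) \<le> C * norm (inverse x)"
    using eventually_not_equal_at_infinity[of "0::real"] by (rule eventually_mono[rotated])
  moreover have "((\<lambda>x::real. C * norm (inverse x)) \<longlongrightarrow> 0) at_infinity"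
    by (intro tendsto_mult_right_zero tendsto_norm_zero tendsto_inverse_0)
  ultimately show ?thesis
    by (rule Lim_null_comparison)
qed

lemma borel_measurable_infsum:
  fixes u :: "'i \<Rightarrow> 'a \<Rightarrow> 'b::{banach, second_countable_topology}"
  assumes "countable A"
    and [measurable]: "\<And>i. i \<in> A \<Longrightarrow> u i \<in> borel_measurable M"
    and summable: "\<And>x. x \<in> space M \<Longrightarrow> (\<lambda>i. norm (u i x)) summable_on A"
  shows "(\<lambda>x. \<Sum>\<^sub>\<infinity>i\<in>A. u i x) \<in> borel_measurable M"
proof -
  interpret sigma_finite_measure "count_space A"
    using assms(1) by (rule sigma_finite_measure_count_space_countable)
  show ?thesis
  proof (rule measurable_cong[THEN iffD2])
    show "(\<Sum>\<^sub>\<infinity>i\<in>A. u i x) = (\<integral>i. u i x \<partial>count_space A)" if "x \<in> space M" for x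
      using infsetsum_infsum[of "\<lambda>i. u i x" A] summable[OF that]
      by (simp add: infsetsum_def abs_summable_equivalent)
    have "(\<lambda>(i, x). u i x) \<in> borel_measurable (count_space A \<Otimes>\<^sub>M M)"
      using assms(1) by (rule measurable_pair_measure_countable1) simp
    from measurable_pair_swap[OF this] show "(\<lambda>x. \<integral>i. u i x \<partial>count_space A) \<in> borel_measurable M"
      by (intro borel_measurable_lebesgue_integral) simp
  qed
qed

lemma rapidly_decreasing_infsum:
  assumes "countable A"
    and meas: "\<And>i. i \<in> A \<Longrightarrow> u i \<in> borel_measurable borel"
    and dominated: "\<And>m. \<exists>b. b summable_on A \<and> (\<forall>i\<in>A. \<forall>x. \<bar>x\<bar> ^ m * norm (u i x) \<le> b i)"
  shows "rapidly_decreasing (\<lambda>x. \<Sum>\<^sub>\<infinity>i\<in>A. u i x)"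
  unfolding rapidly_decreasing_def
proof (intro conjI allI)
  have summable: "(\<lambda>i. norm (u i x)) summable_on A" for x
  proof -
    obtain b where majorant: "b summable_on A" "\<forall>i\<in>A. \<forall>x. \<bar>x\<bar> ^ 0 * norm (u i x) \<le> b i"
      using dominated[of 0] by blast
    then show ?thesis
      by (intro summable_on_comparison_test[OF majorant(1)]) auto
  qed
  show "(\<lambda>x. \<Sum>\<^sub>\<infinity>i\<in>A. u i x) \<in> borel_measurable borel"
    using assms(1) meas summable by (rule borel_measurable_infsum)
  fix m
  obtain b where majorant: "b summable_on A" "\<And>i x. i \<in> A \<Longrightarrow> \<bar>x\<bar> ^ m * norm (u i x) \<le> b i"
    using dominated[of m] by blast
  have "\<bar>x\<bar> ^ m * norm (\<Sum>\<^sub>\<infinity>i\<in>A. u i x) \<le> (\<Sum>\<^sub>\<infinity>i\<in>A. b i)" for x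
  proof -
    have "\<bar>x\<bar> ^ m * norm (\<Sum>\<^sub>\<infinity>i\<in>A. u i x) \<le> \<bar>x\<bar> ^ m * (\<Sum>\<^sub>\<infinity>i\<in>A. norm (u i x))"
      by (intro mult_left_mono norm_infsum_bound summable) auto
    also have "\<dots> = (\<Sum>\<^sub>\<infinity>i\<in>A. \<bar>x\<bar> ^ m * norm (u i x))"
      by (rule infsum_cmult_right'[symmetric])
    also have "\<dots> \<le> (\<Sum>\<^sub>\<infinity>i\<in>A. b i)"
      by (rule infsum_mono) (use majorant summable in \<open>auto intro: summable_on_cmult_right\<close>)
    finally show ?thesis .
  qed
  then show "\<exists>C. \<forall>x. \<bar>x\<bar> ^ m * norm (\<Sum>\<^sub>\<infinity>i\<in>A. u i x) \<le> C"
    by blast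
qed

section \<open>Decay of the punctured sums\<close>

lemma summable_on_int_shift_powers:
  fixes c :: real
  assumes "m \<ge> 2"
  shows "(\<lambda>n::int. inverse (\<bar>of_int n + c\<bar> ^ m)) summable_on UNIV"
proof -
  let ?u = "\<lambda>n::int. inverse (\<bar>of_int n + c\<bar> ^ m)"
  have half_line: "(\<lambda>k::nat. inverse (\<bar>d + of_nat k\<bar> ^ m)) summable_on UNIV" for d :: real
  proof (rule norm_summable_imp_summable_on)
    show "summable (\<lambda>k::nat. norm (inverse (\<bar>d + of_nat k\<bar> ^ m)))"
    proof (rule summable_cong[THEN iffD2])
      show "\<forall>\<^sub>F k in sequentially. norm (inverse (\<bar>d + of_nat k\<bar> ^ m)) = inverse ((d + of_nat k) ^ m)"
        using eventually_ge_at_top[of "nat \<lceil>- d\<rceil>"]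
        by eventually_elim (simp add: power_abs nat_ceiling_le_eq)
      show "summable (\<lambda>k. inverse ((d + of_nat k) ^ m))"
        using Polygamma_converges'[of d m] inverse_power_summable[of m] assms by (cases "d = 0") auto
    qed
  qed
  have "?u summable_on range (\<lambda>k. - int k - 1)"
    using half_line[of "1 - c"]
    by (subst summable_on_reindex) (auto simp: inj_def o_def abs_minus_commute algebra_simps)
  moreover have "?u summable_on range int"
    using half_line[of c] by (subst summable_on_reindex) (auto simp: o_def add.commute)
  moreover have "range int \<union> range (\<lambda>k. - int k - 1) = UNIV"
  proof -
    have "n = int (nat n) \<or> n = - int (nat (- n - 1)) - 1" for n
      by linarith
    then show ?thesis
      by blast
  qed
  ultimately show ?thesis
    using summable_on_union[of ?u "range int" "range (\<lambda>k. - int k - 1)"] by simp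
qed

lemma int_shift_bounded_away_from_0:
  fixes c :: real
  obtains d where "d > 0" "\<And>n::int. of_int n + c \<noteq> 0 \<Longrightarrow> d \<le> \<bar>of_int n + c\<bar>"
proof -
  let ?N = "of_int ` {n. of_int n + c \<noteq> 0}"
  have "- c \<notin> ?N"
    by auto
  then obtain d where gap: "d > 0" "\<And>t. t \<in> ?N \<Longrightarrow> d \<le> dist (- c) t"
    using separate_point_closed[OF closed_of_int_image, of "- c" "{n. of_int n + c \<noteq> 0}"] by blast
  have "d \<le> \<bar>of_int n + c\<bar>" if "of_int n + c \<noteq> 0" for n :: int
    using gap(2)[of "of_int n"] that by (simp add: dist_real_def)
  with gap(1) show thesis
    by (rule that)
qed

lemma rapidly_decreasing_dilation_bound:
  assumes "rapidly_decreasing g" and "d > 0"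
  obtains C where "C \<ge> 0"
    "\<And>x t. x \<ge> 1 \<Longrightarrow> \<bar>t\<bar> \<ge> d \<Longrightarrow> x ^ m * norm (g (t * x)) \<le> C * inverse (\<bar>t\<bar> ^ l)"
proof -
  obtain C where decay: "C \<ge> 0" "\<And>x. \<bar>x\<bar> ^ (m + l) * norm (g x) \<le> C"
    using rapidly_decreasing_bound[OF assms(1)] by blast
  have "x ^ m * norm (g (t * x)) \<le> C / d ^ m * inverse (\<bar>t\<bar> ^ l)" if "x \<ge> 1" "\<bar>t\<bar> \<ge> d" for x t
  proof -
    have "(d ^ m * \<bar>t\<bar> ^ l * x ^ m) * norm (g (t * x)) \<le> \<bar>t * x\<bar> ^ (m + l) * norm (g (t * x))"
    proof (rule mult_right_mono)
      have "d ^ m * \<bar>t\<bar> ^ l * x ^ m * 1 \<le> \<bar>t\<bar> ^ m * \<bar>t\<bar> ^ l * x ^ m * x ^ l"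
        using that assms(2) by (intro mult_mono power_mono one_le_power) auto
      then show "d ^ m * \<bar>t\<bar> ^ l * x ^ m \<le> \<bar>t * x\<bar> ^ (m + l)"
        using that by (simp add: abs_mult power_mult_distrib power_add mult_ac)
    qed simp
    also have "\<dots> \<le> C"
      by (rule decay)
    finally show ?thesis
      using that assms(2) by (simp add: field_simps)
  qed
  then show thesis
    using decay(1) assms(2) by (intro that[of "C / d ^ m"]) auto
qed

lemma punctured_sum_rapidly_decreasing:
  assumes "rapidly_decreasing g"
  shows "rapidly_decreasing (\<lambda>x. indicator {1..} x * punctured_sum a c g x)"
proof -
  define u where "u n x = indicator {1..} x *
      (cis_pi (2 * (a * (of_int n + c / 2))) * ((\<lambda>t. g (t * x))(0 := 0)) (of_int n + c))" for n :: int and x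
  obtain d where gap: "d > 0" "\<And>n::int. of_int n + c \<noteq> 0 \<Longrightarrow> d \<le> \<bar>of_int n + c\<bar>"
    using int_shift_bounded_away_from_0[of c] by blast
  have "rapidly_decreasing (\<lambda>x. \<Sum>\<^sub>\<infinity>n. u n x)"
  proof (rule rapidly_decreasing_infsum)
    note [measurable] = rapidly_decreasing_measurable[OF assms]
    show "u n \<in> borel_measurable borel" for n
      by (cases "of_int n + c = 0") (simp_all add: u_def[abs_def])
    fix m
    obtain C where decay: "C \<ge> 0"
      "\<And>x t. x \<ge> 1 \<Longrightarrow> \<bar>t\<bar> \<ge> d \<Longrightarrow> x ^ m * norm (g (t * x)) \<le> C * inverse (\<bar>t\<bar> ^ 2)"
      using rapidly_decreasing_dilation_bound[OF assms gap(1)] by blast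
    have "\<bar>x\<bar> ^ m * norm (u n x) \<le> C * inverse (\<bar>of_int n + c\<bar> ^ 2)" for n x
      using decay(2)[OF _ gap(2), of x n] decay(1)
      by (cases "x \<ge> 1 \<and> of_int n + c \<noteq> 0") (auto simp: u_def norm_mult)
    then show "\<exists>b. b summable_on UNIV \<and> (\<forall>n\<in>UNIV. \<forall>x. \<bar>x\<bar> ^ m * norm (u n x) \<le> b n)"
      using summable_on_int_shift_powers[of 2 c]
      by (intro exI[of _ "\<lambda>n. C * inverse (\<bar>of_int n + c\<bar> ^ 2)"] conjI summable_on_cmult_right) auto
  qed simp
  then show ?thesis
    by (simp add: u_def infsum_cmult_right' punctured_sum_def lattice_sum_def)
qed

section \<open>Holomorphic parameter integrals\<close>

lemma norm_deriv_le_of_bounded_holomorphic: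
  assumes "f holomorphic_on S" and "cball u r \<subseteq> S" and "r > 0" and "\<And>v. v \<in> S \<Longrightarrow> norm (f v) \<le> B"
  shows "norm (deriv f u) \<le> B / r"
proof -
  have holomorphic_cball: "f holomorphic_on cball u r"
    using assms(1,2) by (rule holomorphic_on_subset)
  have "norm ((deriv ^^ 1) f u) \<le> fact 1 * B / r ^ 1"
  proof (rule Cauchy_inequality)
    show "f holomorphic_on ball u r"
      using holomorphic_cball ball_subset_cball by (rule holomorphic_on_subset)
    show "continuous_on (cball u r) f"
      using holomorphic_cball by (rule holomorphic_on_imp_continuous_on)
    show "norm (f v) \<le> B" if "norm (u - v) = r" for v
      using that assms(2,4) by (auto simp: subset_iff dist_norm)
  qed (rule assms(3))
  then show ?thesis
    by simp
qed

lemma norm_diff_le_of_bounded_holomorphic: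
  assumes "f holomorphic_on ball z r" and "\<And>u. u \<in> ball z r \<Longrightarrow> norm (f u) \<le> B" and "w \<in> ball z (r / 2)"
  shows "norm (f w - f z) \<le> 2 * B / r * norm (w - z)"
proof -
  have "0 \<le> dist z w"
    by simp
  also have "\<dots> < r / 2"
    using assms(3) by simp
  finally have r_pos: "r > 0"
    by simp
  show ?thesis
  proof (rule field_differentiable_bound[OF convex_ball[of z "r / 2"]])
    fix u
    assume u_near: "u \<in> ball z (r / 2)"
    then have "u \<in> ball z r"
      using r_pos by simp
    then show "(f has_field_derivative deriv f u) (at u within ball z (r / 2))"
      by (rule holomorphic_derivI[OF assms(1) open_ball])
    have "cball u (r / 2) \<subseteq> ball z r"
      using u_near by (simp add: cball_subset_ball_iff dist_commute)
    then have "norm (deriv f u) \<le> B / (r / 2)"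
      using assms(1,2) r_pos by (intro norm_deriv_le_of_bounded_holomorphic) auto
    then show "norm (deriv f u) \<le> 2 * B / r"
      by (simp add: mult.commute)
  qed (use assms(3) r_pos in simp_all)
qed

context
  fixes F :: "complex \<Rightarrow> 'a \<Rightarrow> complex" and M :: "'a measure" and w :: "'a \<Rightarrow> real" and z :: complex and r :: real
  assumes r_pos: "r > 0" and measurable_F: "\<And>u. u \<in> ball z r \<Longrightarrow> F u \<in> borel_measurable M"
    and holomorphic_F: "\<And>x. x \<in> space M \<Longrightarrow> (\<lambda>u. F u x) holomorphic_on ball z r"
    and integrable_w: "integrable M w"
    and dominated: "\<And>u x. u \<in> ball z r \<Longrightarrow> x \<in> space M \<Longrightarrow> norm (F u x) \<le> w x"
begin

lemma integral_difference_quotient_LIMSEQ: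
  assumes u_near: "\<And>i. u i \<in> ball z (r / 2)" and u_neq: "\<And>i. u i \<noteq> z" and u_lim: "u \<longlonglongrightarrow> z"
  shows "(\<lambda>i. \<integral>x. (F (u i) x - F z x) / (u i - z) \<partial>M) \<longlonglongrightarrow> (\<integral>x. deriv (\<lambda>u. F u x) z \<partial>M)"
proof (rule integral_dominated_convergence[where w = "\<lambda>x. 2 * w x / r"])
  let ?Q = "\<lambda>u x. (F u x - F z x) / (u - z)"
  have quotient_limit: "(\<lambda>i. ?Q (u i) x) \<longlonglongrightarrow> deriv (\<lambda>u. F u x) z" if "x \<in> space M" for x
  proof -
    have "((\<lambda>u. F u x) has_field_derivative deriv (\<lambda>u. F u x) z) (at z)"
      using r_pos by (intro holomorphic_derivI[OF holomorphic_F[OF that] open_ball]) simp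
    moreover have "filterlim u (at z) sequentially"
      using u_lim u_neq by (simp add: filterlim_at)
    ultimately show ?thesis
      unfolding has_field_derivative_iff by (rule filterlim_compose)
  qed
  then show "AE x in M. (\<lambda>i. ?Q (u i) x) \<longlonglongrightarrow> deriv (\<lambda>u. F u x) z"
    by (rule AE_I2)
  show quotient_measurable: "?Q (u i) \<in> borel_measurable M" for i
    using measurable_F[of "u i"] measurable_F[of z] u_near[of i] r_pos by simp
  show "(\<lambda>x. deriv (\<lambda>u. F u x) z) \<in> borel_measurable M"
    using quotient_measurable quotient_limit by (rule borel_measurable_LIMSEQ_metric)
  show "AE x in M. norm (?Q (u i) x) \<le> 2 * w x / r" for i
  proof (rule AE_I2)
    fix x
    assume "x \<in> space M"
    then have "norm (F (u i) x - F z x) \<le> 2 * w x / r * norm (u i - z)"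
      by (intro norm_diff_le_of_bounded_holomorphic holomorphic_F dominated u_near)
    then show "norm (?Q (u i) x) \<le> 2 * w x / r"
      using u_neq[of i] by (simp add: norm_divide pos_divide_le_eq)
  qed
qed (use integrable_w in simp)

lemma has_field_derivative_lebesgue_integral:
  "((\<lambda>u. \<integral>x. F u x \<partial>M) has_field_derivative (\<integral>x. deriv (\<lambda>u. F u x) z \<partial>M)) (at z)"
proof -
  let ?I = "\<lambda>u. \<integral>x. F u x \<partial>M" and ?B = "ball z (r / 2)"
  have integrable: "integrable M (F u)" if "u \<in> ball z r" for u
    using that measurable_F dominated
    by (intro Bochner_Integration.integrable_bound[OF integrable_w] AE_I2)
      (auto intro: order_trans[OF _ abs_ge_self])
  have "((\<lambda>u. (?I u - ?I z) / (u - z)) \<longlongrightarrow> (\<integral>x. deriv (\<lambda>u. F u x) z \<partial>M)) (at z within ?B)"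
    unfolding tendsto_at_iff_sequentially
  proof (intro allI impI)
    fix u :: "nat \<Rightarrow> complex"
    assume u_in: "\<forall>i. u i \<in> ?B - {z}" and u_lim: "u \<longlonglongrightarrow> z"
    have u_near: "u i \<in> ?B" "u i \<in> ball z r" and u_neq: "u i \<noteq> z" for i
      using u_in[rule_format, of i] r_pos by auto
    have integral_quotient: "(?I (u i) - ?I z) / (u i - z) = (\<integral>x. (F (u i) x - F z x) / (u i - z) \<partial>M)" for i
      using integrable[OF u_near(2)] integrable[of z] r_pos by simp
    have "(\<lambda>i. (?I (u i) - ?I z) / (u i - z)) \<longlonglongrightarrow> (\<integral>x. deriv (\<lambda>u. F u x) z \<partial>M)"
      unfolding integral_quotient using u_near(1) u_neq u_lim by (rule integral_difference_quotient_LIMSEQ)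
    then show "((\<lambda>u. (?I u - ?I z) / (u - z)) \<circ> u) \<longlonglongrightarrow> (\<integral>x. deriv (\<lambda>u. F u x) z \<partial>M)"
      by (simp add: o_def)
  qed
  then show ?thesis
    using r_pos by (simp add: has_field_derivative_iff at_within_open[of z ?B])
qed

end

section \<open>Mellin integrals over \<open>[1, \<infinity>)\<close>\<close>

lemma norm_powr_le_power:
  assumes "x \<ge> (1::real)" and "Re w \<le> real N"
  shows "norm (of_real x powr w :: complex) \<le> x ^ N"
proof -
  have "norm (of_real x powr w :: complex) = x powr Re w"
    using assms(1) by (simp add: norm_powr_real_powr)
  also have "\<dots> \<le> x powr real N"
    using assms by (intro powr_mono)
  also have "\<dots> = x ^ N"
    using assms(1) by (simp add: powr_realpow)
  finally show ?thesis .
qed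

lemma norm_powr_le_power_on_ball:
  assumes "x \<ge> (1::real)" and "u \<in> ball s 1"
  shows "norm (of_real x powr (u - 1) :: complex) \<le> x ^ nat \<lceil>Re s\<rceil>"
proof (rule norm_powr_le_power[OF assms(1)])
  have "Re u - Re s \<le> norm (s - u)"
    using abs_Re_le_cmod[of "s - u"] by simp
  also have "\<dots> < 1"
    using assms(2) by (simp add: dist_norm)
  finally show "Re (u - 1) \<le> real (nat \<lceil>Re s\<rceil>)"
    by simp linarith
qed

lemma mellin_tail_holomorphic:
  assumes "rapidly_decreasing (\<lambda>x. indicator {1..} x * S x)"
  shows "mellin_tail S holomorphic_on UNIV"
proof -
  define U where "U x = indicator {1..} x * S x" for x
  define F where "F u x = U x * of_real x powr (u - 1)" for u x
  have U_rapid: "rapidly_decreasing U"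
    using assms by (simp add: U_def[abs_def])
  note [measurable] = rapidly_decreasing_measurable[OF U_rapid]
  have "(\<lambda>u. LBINT x. F u x) field_differentiable (at s)" for s
  proof -
    let ?N = "nat \<lceil>Re s\<rceil>"
    have "((\<lambda>u. LBINT x. F u x) has_field_derivative (LBINT x. deriv (\<lambda>u. F u x) s)) (at s)"
    proof (rule has_field_derivative_lebesgue_integral[where r = 1 and w = "\<lambda>x. norm (of_real x ^ ?N * U x)"])
      show "F u \<in> borel_measurable lborel" for u
        unfolding F_def by measurable
      show "(\<lambda>u. F u x) holomorphic_on ball s 1" for x
      proof (cases "x \<ge> 1")
        case True
        then show ?thesis
          unfolding F_def by (intro holomorphic_intros) auto
      qed (simp add: F_def U_def)
      show "integrable lborel (\<lambda>x. norm (of_real x ^ ?N * U x))"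
        by (intro integrable_norm rapidly_decreasing_integrable rapidly_decreasing_power_mult U_rapid)
      show "norm (F u x) \<le> norm (of_real x ^ ?N * U x)" if "u \<in> ball s 1" for u x
      proof (cases "x \<ge> 1")
        case True
        then have "norm (of_real x powr (u - 1) :: complex) * norm (U x) \<le> x ^ ?N * norm (U x)"
          using that by (intro mult_right_mono norm_powr_le_power_on_ball) auto
        then show ?thesis
          using True by (simp add: F_def norm_mult norm_power mult.commute)
      qed (simp add: F_def U_def)
    qed simp
    then show ?thesis
      unfolding field_differentiable_def by blast
  qed
  moreover have "mellin_tail S = (\<lambda>s. LBINT x. F s x)"
    by (auto simp: fun_eq_iff mellin_tail_def set_lebesgue_integral_def F_def U_def indicator_def
        intro!: Bochner_Integration.integral_cong)
  ultimately show ?thesis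
    by (simp add: holomorphic_on_def field_differentiable_at_within)
qed

section \<open>Poles of \<open>F\<^sub>k\<close>\<close>

lemma Phi_entire_holomorphic:
  assumes "rapidly_decreasing f"
  shows "(\<lambda>s. Phi_entire k f s a c) holomorphic_on UNIV"
  unfolding Phi_entire_def
  using rapidly_decreasing_reflect[OF assms] assms
  by (intro holomorphic_intros mellin_tail_holomorphic punctured_sum_rapidly_decreasing)

definition Fk_entire :: "nat \<Rightarrow> (real \<Rightarrow> complex) \<Rightarrow> complex \<Rightarrow> real \<Rightarrow> real \<Rightarrow> complex" where
  "Fk_entire k f s a c =
     Phi_entire k f s a c + (-1) ^ k * cis_pi (- a) * Phi_entire k (fourier f) (1 - s) (1 - c) a"

definition Fk_residue_0 :: "nat \<Rightarrow> (real \<Rightarrow> complex) \<Rightarrow> real \<Rightarrow> real \<Rightarrow> complex" where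
  "Fk_residue_0 k f a c = - ((1 + (-1) ^ k) * delta_Z c * cis_pi (- (a * c)) * f 0)"

definition Fk_residue_1 :: "nat \<Rightarrow> (real \<Rightarrow> complex) \<Rightarrow> real \<Rightarrow> real \<Rightarrow> complex" where
  "Fk_residue_1 k f a c = (1 + (-1) ^ k) * delta_Z a * cis_pi (a * c) * fourier f 0"

lemma Fk_entire_holomorphic:
  assumes "rapidly_decreasing f" "rapidly_decreasing (fourier f)"
  shows "(\<lambda>s. Fk_entire k f s a c) holomorphic_on UNIV"
proof -
  have "(\<lambda>s. Phi_entire k (fourier f) s (1 - c) a) \<circ> (\<lambda>s. 1 - s) holomorphic_on UNIV"
    by (rule holomorphic_on_compose_gen[OF _ Phi_entire_holomorphic[OF assms(2)]])
      (auto intro!: holomorphic_intros)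
  then show ?thesis
    unfolding Fk_entire_def o_def
    by (intro holomorphic_intros Phi_entire_holomorphic[OF assms(1)])
qed

lemma Fk_eq_entire_plus_poles:
  "Fk k f s a c = Fk_entire k f s a c + Fk_residue_0 k f a c / s + Fk_residue_1 k f a c / (s - 1)"
proof -
  have residue_phase: "cis_pi (- a) * (delta_Z a * cis_pi (- ((1 - c) * a))) = delta_Z a * cis_pi (a * c)"
  proof (cases "a \<in> \<int>")
    case True
    then obtain m where a_eq: "a = of_int m"
      by (auto elim: Ints_cases)
    have "cis_pi (- a) * cis_pi (- ((1 - c) * a)) = cis_pi (a * c)"
      unfolding cis_pi_add[symmetric] by (rule cis_pi_cong[where n = "- m"]) (simp add: a_eq field_simps)
    then show ?thesis
      by (simp add: mult.left_commute)
  qed (simp add: delta_Z_def)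
  have parity: "(-1) ^ k * (1 + (-1) ^ k) = (1 + (-1) ^ k :: complex)"
    by (simp add: distrib_left flip: power_mult_distrib)
  have "(-1) ^ k * cis_pi (- a) * ((1 + (-1) ^ k) * fourier f 0 * (delta_Z a * cis_pi (- ((1 - c) * a))) / (1 - s))
      = ((-1) ^ k * (1 + (-1) ^ k)) * (cis_pi (- a) * (delta_Z a * cis_pi (- ((1 - c) * a)))) * fourier f 0 / (1 - s)"
    by (simp add: mult_ac)
  also have "\<dots> = - (Fk_residue_1 k f a c / (s - 1))"
    unfolding residue_phase parity Fk_residue_1_def by (subst minus_divide_right) (simp add: mult_ac)
  finally show ?thesis
    unfolding Fk_eq Phi_eq Fk_entire_def Fk_residue_0_def right_diff_distrib lattice_sum_indicator_0
    by (simp add: mult_ac)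
qed

lemma residue_plus_simple_fraction:
  assumes "H holomorphic_on S" "open S" "p \<in> S"
  shows "residue (\<lambda>s. H s + r / (s - p)) p = r"
proof -
  have "residue (\<lambda>s. (H s * (s - p) + r) / (s - p)) p = H p * (p - p) + r"
    using assms by (intro residue_simple[where s = S] holomorphic_intros)
  moreover have "\<forall>\<^sub>F s in at p. H s + r / (s - p) = (H s * (s - p) + r) / (s - p)"
    using eventually_neq_at_within[of p] by eventually_elim (simp add: field_simps)
  ultimately show ?thesis
    using residue_cong by fastforce
qed

lemma zorder_plus_simple_fraction:
  assumes "H holomorphic_on S" "open S" "p \<in> S" and pole: "is_pole (\<lambda>s. H s + r / (s - p)) p"
  shows "zorder (\<lambda>s. H s + r / (s - p)) p = - 1"
proof (rule zorder_eqI[OF assms(2,3)])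
  show "(\<lambda>s. H s * (s - p) + r) holomorphic_on S"
    by (intro holomorphic_intros assms(1))
  have "r \<noteq> 0"
  proof
    assume "r = 0"
    with pole have "is_pole H p"
      by simp
    with not_is_pole_holomorphic[OF assms(2,3,1)] show False ..
  qed
  then show "H p * (p - p) + r \<noteq> 0"
    by simp
qed (simp add: field_simps)

context
  fixes f :: "real \<Rightarrow> complex"
  assumes rapid: "rapidly_decreasing f" "rapidly_decreasing (fourier f)"
begin

lemma Fk_regular_at_0_holomorphic:
  "(\<lambda>s. Fk_entire k f s a c + Fk_residue_1 k f a c / (s - 1)) holomorphic_on - {1}"
  by (intro holomorphic_intros holomorphic_on_subset[OF Fk_entire_holomorphic[OF rapid]]) auto

lemma Fk_regular_at_1_holomorphic:
  "(\<lambda>s. Fk_entire k f s a c + Fk_residue_0 k f a c / s) holomorphic_on - {0}"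
  by (intro holomorphic_intros holomorphic_on_subset[OF Fk_entire_holomorphic[OF rapid]]) auto

lemma Fk_eq_regular_at_0:
  "Fk k f s a c = (Fk_entire k f s a c + Fk_residue_1 k f a c / (s - 1)) + Fk_residue_0 k f a c / (s - 0)"
  by (simp add: Fk_eq_entire_plus_poles)

lemma Fk_eq_regular_at_1:
  "Fk k f s a c = (Fk_entire k f s a c + Fk_residue_0 k f a c / s) + Fk_residue_1 k f a c / (s - 1)"
  by (simp add: Fk_eq_entire_plus_poles)

lemma Fk_meromorphic: "(\<lambda>s. Fk k f s a c) meromorphic_on UNIV"
  unfolding Fk_eq_entire_plus_poles using Fk_entire_holomorphic[OF rapid]
  by (intro meromorphic_intros analytic_on_imp_meromorphic_on) (auto simp: analytic_on_open)

lemma Fk_holomorphic_off_poles: "(\<lambda>s. Fk k f s a c) holomorphic_on UNIV - {0, 1}"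
  unfolding Fk_eq_entire_plus_poles
  by (intro holomorphic_intros holomorphic_on_subset[OF Fk_entire_holomorphic[OF rapid]]) auto

lemma Fk_holomorphic:
  assumes "odd k \<or> a \<notin> \<int> \<and> c \<notin> \<int>"
  shows "(\<lambda>s. Fk k f s a c) holomorphic_on UNIV"
  using assms Fk_entire_holomorphic[OF rapid]
  by (auto simp: Fk_eq_entire_plus_poles Fk_residue_0_def Fk_residue_1_def delta_Z_def)

lemma Fk_analytic_at_0:
  assumes "c \<notin> \<int>"
  shows "(\<lambda>s. Fk k f s a c) analytic_on {0}"
proof -
  have "(\<lambda>s. Fk k f s a c) holomorphic_on - {1}"
    using Fk_regular_at_0_holomorphic assms by (simp add: Fk_eq_regular_at_0 Fk_residue_0_def delta_Z_def)
  then show ?thesis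
    by (rule holomorphic_on_imp_analytic_at) auto
qed

lemma Fk_analytic_at_1:
  assumes "a \<notin> \<int>"
  shows "(\<lambda>s. Fk k f s a c) analytic_on {1}"
proof -
  have "(\<lambda>s. Fk k f s a c) holomorphic_on - {0}"
    using Fk_regular_at_1_holomorphic assms by (simp add: Fk_eq_regular_at_1 Fk_residue_1_def delta_Z_def)
  then show ?thesis
    by (rule holomorphic_on_imp_analytic_at) auto
qed

lemma zorder_Fk_pole_0:
  assumes "is_pole (\<lambda>s. Fk k f s a c) 0"
  shows "zorder (\<lambda>s. Fk k f s a c) 0 = - 1"
  using assms unfolding Fk_eq_regular_at_0
  by (intro zorder_plus_simple_fraction[OF Fk_regular_at_0_holomorphic]) auto

lemma zorder_Fk_pole_1:
  assumes "is_pole (\<lambda>s. Fk k f s a c) 1"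
  shows "zorder (\<lambda>s. Fk k f s a c) 1 = - 1"
  using assms unfolding Fk_eq_regular_at_1
  by (intro zorder_plus_simple_fraction[OF Fk_regular_at_1_holomorphic]) auto

lemma residue_Fk_0: "residue (\<lambda>s. Fk k f s a c) 0 = Fk_residue_0 k f a c"
  unfolding Fk_eq_regular_at_0
  by (rule residue_plus_simple_fraction[OF Fk_regular_at_0_holomorphic]) auto

lemma residue_Fk_1: "residue (\<lambda>s. Fk k f s a c) 1 = Fk_residue_1 k f a c"
  unfolding Fk_eq_regular_at_1
  by (rule residue_plus_simple_fraction[OF Fk_regular_at_1_holomorphic]) auto

end

section \<open>The Fourier transform\<close>

lemma cis_pi_measurable [measurable]: "cis_pi \<in> borel_measurable borel"
  unfolding cis_pi_def by (intro borel_measurable_continuous_onI continuous_intros)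

lemma fourier_eq: "fourier f y = (LBINT x. cis_pi (- 2 * (x * y)) * f x)"
  by (simp only: fourier_def exp_eq_cis_pi)

lemma fourier_measurable:
  assumes [measurable]: "f \<in> borel_measurable borel"
  shows "fourier f \<in> borel_measurable borel"
  unfolding fourier_eq[abs_def] by measurable

lemma norm_fourier_le: "norm (fourier f y) \<le> (LBINT x. norm (f x))"
  unfolding fourier_eq by (rule order_trans[OF integral_norm_bound]) (simp add: norm_mult)

lemma integrable_cis_pi_mult:
  assumes "integrable lborel g" and [measurable]: "h \<in> borel_measurable borel"
  shows "integrable lborel (\<lambda>x. cis_pi (h x) * g x)"
proof -
  have [measurable]: "g \<in> borel_measurable borel"
    using assms(1) by simp
  show ?thesis
    by (rule Bochner_Integration.integrable_bound[OF assms(1)]) (auto simp: norm_mult)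
qed

lemma fourier_scale:
  assumes "c \<noteq> 0"
  shows "fourier (\<lambda>x. f (c * x)) y = fourier f (y / c) / of_real \<bar>c\<bar>"
proof -
  have "fourier f (y / c) = \<bar>c\<bar> *\<^sub>R (LBINT x. cis_pi (- 2 * ((0 + c * x) * (y / c))) * f (0 + c * x))"
    unfolding fourier_eq using assms by (rule lborel_integral_real_affine)
  also have "\<dots> = of_real \<bar>c\<bar> * fourier (\<lambda>x. f (c * x)) y"
    using assms by (simp add: fourier_eq scaleR_conv_of_real)
  finally show ?thesis
    using assms by simp
qed

lemma fourier_modulation: "fourier (\<lambda>x. cis_pi (2 * (t * x)) * f x) y = fourier f (y - t)"
proof -
  have "cis_pi (- 2 * (x * y)) * (cis_pi (2 * (t * x)) * f x) = cis_pi (- 2 * (x * (y - t))) * f x" for x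
    by (simp add: algebra_simps flip: mult.assoc cis_pi_add)
  then show ?thesis
    by (simp only: fourier_eq)
qed

lemma integral_fourier_mult:
  assumes f_integrable: "integrable lborel f" and g_integrable: "integrable lborel g"
  shows "(LBINT y. fourier f y * g y) = (LBINT x. f x * fourier g x)"
proof -
  have [measurable]: "f \<in> borel_measurable borel" "g \<in> borel_measurable borel"
    using f_integrable g_integrable by simp_all
  let ?K = "\<lambda>x y. cis_pi (- 2 * (x * y)) * f x * g y"
  have norm_K: "norm (?K x y) = norm (f x) * norm (g y)" for x y
    by (simp add: norm_mult)
  have "integrable (lborel \<Otimes>\<^sub>M lborel) (case_prod ?K)"
  proof (rule lborel_pair.Fubini_integrable)
    show "integrable lborel (\<lambda>x. LBINT y. norm (case_prod ?K (x, y)))"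
      unfolding prod.case norm_K using f_integrable by simp
    have "integrable lborel (\<lambda>y. cis_pi (- 2 * (x * y)) * (f x * g y))" for x
      using g_integrable by (intro integrable_cis_pi_mult integrable_mult_right) auto
    then show "AE x in lborel. integrable lborel (\<lambda>y. case_prod ?K (x, y))"
      by (simp add: mult.assoc)
  qed measurable
  then have "(LBINT y. LBINT x. ?K x y) = (LBINT x. LBINT y. ?K x y)"
    by (rule lborel_pair.Fubini_integral)
  moreover have "(LBINT x. ?K x y) = fourier f y * g y" for y
    by (simp add: fourier_eq)
  moreover have "(LBINT y. ?K x y) = f x * fourier g x" for x
    unfolding fourier_eq integral_mult_right_zero[symmetric] by (simp add: mult_ac)
  ultimately show ?thesis
    by (simp only:)
qed

lemma fourier_vector_derivative:
  assumes deriv: "\<And>x. (f has_vector_derivative f' x) (at x)" and cont: "\<And>x. isCont f' x"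
    and integrable: "integrable lborel f" "integrable lborel f'"
    and lim: "(f \<longlongrightarrow> 0) at_infinity"
  shows "fourier f' y = 2 * pi * \<i> * y * fourier f y"
proof -
  let ?e = "\<lambda>x. cis_pi (- 2 * (x * y))"
  let ?D = "\<lambda>x. ?e x * f' x - 2 * pi * \<i> * y * (?e x * f x)"
  have phase_deriv: "(?e has_vector_derivative - 2 * pi * \<i> * y * ?e x) (at x)" for x
    unfolding exp_eq_cis_pi(4)[symmetric]
    by (auto intro!: derivative_eq_intros has_vector_derivative_real_field)
  have integrable_e: "integrable lborel (\<lambda>x. ?e x * f' x)" "integrable lborel (\<lambda>x. ?e x * f x)"
    by (intro integrable_cis_pi_mult integrable; measurable)+
  have "((\<lambda>x. ?e x * f x) \<longlongrightarrow> 0) at_infinity"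
    by (rule tendsto_norm_zero_cancel) (use tendsto_norm_zero[OF lim] in \<open>simp add: norm_mult\<close>)
  then have lims: "((\<lambda>x. ?e x * f x) \<longlongrightarrow> 0) at_top" "((\<lambda>x. ?e x * f x) \<longlongrightarrow> 0) at_bot"
    by (auto intro: tendsto_mono[OF at_top_le_at_infinity] tendsto_mono[OF at_bot_le_at_infinity])
  have "(LBINT x=-\<infinity>..\<infinity>. ?D x) = 0 - 0"
  proof (rule interval_integral_FTC_integrable)
    show "((\<lambda>x. ?e x * f x) has_vector_derivative ?D x) (at x)" for x
      using has_vector_derivative_mult[OF phase_deriv deriv] by (simp add: algebra_simps)
    show "isCont ?D x" for x
      using has_vector_derivative_continuous[OF phase_deriv] has_vector_derivative_continuous[OF deriv]
      by (intro continuous_intros cont)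
    show "set_integrable lborel (einterval (- \<infinity>) \<infinity>) ?D"
      using integrable_e by (simp add: set_integrable_def)
  qed (use lims in \<open>auto simp: ereal_tendsto_simps\<close>)
  then have "(LBINT x. ?D x) = 0"
    by (simp add: interval_lebesgue_integral_def set_lebesgue_integral_def)
  then show ?thesis
    unfolding fourier_eq using integrable_e by simp
qed

section \<open>Fourier inversion\<close>

lemma fourier_std_normal_density:
  "fourier (\<lambda>x. of_real (std_normal_density x)) y = of_real (exp (- ((2 * pi * y)\<^sup>2) / 2))"
proof -
  have "char std_normal_distribution (- 2 * pi * y)
      = (LBINT x. std_normal_density x *\<^sub>R exp (\<i> * of_real (- 2 * pi * y * x)))"
    unfolding char_def by (subst integral_density) auto
  also have "(\<lambda>x. std_normal_density x *\<^sub>R exp (\<i> * of_real (- 2 * pi * y * x)))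
      = (\<lambda>x. cis_pi (- 2 * (x * y)) * of_real (std_normal_density x))"
    by (simp add: cis_pi_def cis_conv_exp scaleR_conv_of_real mult_ac)
  finally show ?thesis
    by (simp add: fourier_eq char_std_normal_distribution)
qed

definition gaussian :: "real \<Rightarrow> real \<Rightarrow> real" where
  "gaussian \<epsilon> x = exp (- ((2 * pi * \<epsilon> * x)\<^sup>2) / 2)"

lemma gaussian_measurable [measurable]: "gaussian \<epsilon> \<in> borel_measurable borel"
  unfolding gaussian_def[abs_def] by measurable

lemma gaussian_eq_std_normal_density:
  "gaussian \<epsilon> x = sqrt (2 * pi) * std_normal_density ((2 * pi * \<epsilon>) * x)"
  by (simp add: gaussian_def std_normal_density_def)

lemma fourier_gaussian:
  assumes "\<epsilon> > 0"
  shows "fourier (\<lambda>x. of_real (gaussian \<epsilon> x)) y = of_real (std_normal_density (y / \<epsilon>) / \<epsilon>)"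
proof -
  have "fourier (\<lambda>x. of_real (gaussian \<epsilon> x)) y
      = of_real (sqrt (2 * pi)) * fourier (\<lambda>x. of_real (std_normal_density ((2 * pi * \<epsilon>) * x))) y"
    by (simp add: gaussian_eq_std_normal_density fourier_eq mult.left_commute)
  also have "\<dots> = of_real (sqrt (2 * pi)) * (of_real (exp (- ((y / \<epsilon>)\<^sup>2) / 2)) / of_real (2 * pi * \<epsilon>))"
    using assms by (subst fourier_scale) (simp_all add: fourier_std_normal_density)
  also have "\<dots> = of_real (std_normal_density (y / \<epsilon>) / \<epsilon>)"
  proof -
    have "2 * pi = sqrt (2 * pi) * sqrt (2 * pi)"
      by simp
    then have "sqrt (2 * pi) * (t / (2 * pi * \<epsilon>)) = 1 / sqrt (2 * pi) * t / \<epsilon>" for t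
      using assms by (simp add: field_simps)
    then show ?thesis
      by (simp only: std_normal_density_def flip: of_real_mult of_real_divide)
  qed
  finally show ?thesis .
qed

lemma integrable_gaussian:
  assumes "\<epsilon> > 0"
  shows "integrable lborel (gaussian \<epsilon>)"
proof -
  have "integrable lborel (\<lambda>y. sqrt (2 * pi) * std_normal_density (0 + (2 * pi * \<epsilon>) * y))"
    using assms by (intro integrable_mult_right lborel_integrable_real_affine) auto
  then show ?thesis
    by (simp flip: gaussian_eq_std_normal_density)
qed

lemma integral_fourier_gaussian:
  assumes f_integrable: "integrable lborel f" and "\<epsilon> > 0"
  shows "(LBINT y. fourier f y * (cis_pi (2 * (x * y)) * gaussian \<epsilon> y))
    = (\<integral>u. f (x + \<epsilon> * u) \<partial>std_normal_distribution)"
proof -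
  let ?g = "\<lambda>y. of_real (gaussian \<epsilon> y) :: complex"
  have [measurable]: "f \<in> borel_measurable borel"
    using f_integrable by simp
  have "(LBINT y. fourier f y * (cis_pi (2 * (x * y)) * ?g y))
      = (LBINT z. f z * fourier (\<lambda>y. cis_pi (2 * (x * y)) * ?g y) z)"
    using f_integrable by (rule integral_fourier_mult)
      (intro integrable_cis_pi_mult integrable_of_real integrable_gaussian \<open>\<epsilon> > 0\<close>; measurable)
  also have "\<dots> = (LBINT z. f z * of_real (std_normal_density ((z - x) / \<epsilon>) / \<epsilon>))"
    unfolding fourier_modulation fourier_gaussian[OF \<open>\<epsilon> > 0\<close>] ..
  also have "\<dots> = \<epsilon> *\<^sub>R (LBINT u. f (x + \<epsilon> * u) * of_real (std_normal_density ((x + \<epsilon> * u - x) / \<epsilon>) / \<epsilon>))"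
    using \<open>\<epsilon> > 0\<close> by (subst lborel_integral_real_affine[where c = \<epsilon> and t = x]) auto
  also have "\<dots> = (LBINT u. std_normal_density u *\<^sub>R f (x + \<epsilon> * u))"
    unfolding integral_scaleR_right[symmetric] using \<open>\<epsilon> > 0\<close> by (simp add: scaleR_conv_of_real mult_ac)
  also have "\<dots> = (\<integral>u. f (x + \<epsilon> * u) \<partial>std_normal_distribution)"
    by (subst integral_density) auto
  finally show ?thesis .
qed

lemma (in prob_space) expectation_vanishing_perturbation:
  fixes f :: "real \<Rightarrow> 'b::{banach, second_countable_topology}"
  assumes [measurable]: "f \<in> borel_measurable borel" "random_variable borel X"
    and bounded: "\<And>t. norm (f t) \<le> B" and cont: "isCont f x" and lim: "\<epsilon> \<longlonglongrightarrow> 0"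
  shows "(\<lambda>n. \<integral>\<omega>. f (x + \<epsilon> n * X \<omega>) \<partial>M) \<longlonglongrightarrow> f x"
proof -
  have "(\<lambda>n. f (x + \<epsilon> n * t)) \<longlonglongrightarrow> f x" for t
  proof (rule isCont_tendsto_compose[OF cont])
    have "(\<lambda>n. x + \<epsilon> n * t) \<longlonglongrightarrow> x + 0 * t"
      by (intro tendsto_intros lim)
    then show "(\<lambda>n. x + \<epsilon> n * t) \<longlonglongrightarrow> x"
      by simp
  qed
  then have "(\<lambda>n. \<integral>\<omega>. f (x + \<epsilon> n * X \<omega>) \<partial>M) \<longlonglongrightarrow> (\<integral>\<omega>. f x \<partial>M)"
    by (intro integral_dominated_convergence[where w = "\<lambda>_. B"] AE_I2 bounded) auto
  then show ?thesis
    by (simp add: prob_space)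
qed

text \<open>
  As \<open>\<epsilon>\<close> tends to \<open>0\<close>, the left-hand side of \<open>integral_fourier_gaussian\<close> converges to the
  inversion integral, and the right-hand side, an average of \<open>f\<close> against a shrinking Gaussian, to \<open>f x\<close>.
\<close>

theorem fourier_inversion:
  assumes f_integrable: "integrable lborel f" and fourier_integrable: "integrable lborel (fourier f)"
    and bounded: "\<And>x. norm (f x) \<le> B" and cont: "isCont f (- x)"
  shows "fourier (fourier f) x = f (- x)"
proof -
  interpret normal: prob_space std_normal_distribution
    by (simp add: prob_space_normal_density)
  have [measurable]: "f \<in> borel_measurable borel" "fourier f \<in> borel_measurable borel"
    using f_integrable fourier_integrable by simp_all
  define \<epsilon> :: "nat \<Rightarrow> real" where "\<epsilon> n = inverse (real (Suc n))" for n
  have pos: "\<epsilon> n > 0" for n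
    by (simp add: \<epsilon>_def)
  have lim: "\<epsilon> \<longlonglongrightarrow> 0"
    unfolding \<epsilon>_def by (rule LIMSEQ_inverse_real_of_nat)
  let ?h = "\<lambda>n y. fourier f y * (cis_pi (2 * (- x * y)) * gaussian (\<epsilon> n) y)"
  have "(\<lambda>n. LBINT y. ?h n y) \<longlonglongrightarrow> (LBINT y. cis_pi (- 2 * (y * x)) * fourier f y)"
  proof (rule integral_dominated_convergence[where w = "\<lambda>y. norm (fourier f y)"])
    have "(\<lambda>n. gaussian (\<epsilon> n) y) \<longlonglongrightarrow> exp (- ((2 * pi * 0 * y)\<^sup>2) / 2)" for y
      unfolding gaussian_def by (intro tendsto_intros lim) simp
    then have "(\<lambda>n. ?h n y) \<longlonglongrightarrow> fourier f y * (cis_pi (2 * (- x * y)) * of_real 1)" for y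
      by (intro tendsto_intros) simp
    then show "AE y in lborel. (\<lambda>n. ?h n y) \<longlonglongrightarrow> cis_pi (- 2 * (y * x)) * fourier f y"
      by (simp add: mult_ac)
    show "AE y in lborel. norm (?h n y) \<le> norm (fourier f y)" for n
      by (rule AE_I2) (simp add: norm_mult gaussian_def mult_right_le_one_le)
  qed (use fourier_integrable in auto)
  moreover have "(LBINT y. ?h n y) = (\<integral>u. f (- x + \<epsilon> n * u) \<partial>std_normal_distribution)" for n
    using f_integrable pos by (rule integral_fourier_gaussian)
  moreover have "(\<lambda>n. \<integral>u. f (- x + \<epsilon> n * u) \<partial>std_normal_distribution) \<longlonglongrightarrow> f (- x)"
    using bounded cont lim by (intro normal.expectation_vanishing_perturbation) auto
  ultimately show ?thesis
    by (auto simp: fourier_eq[of "fourier f" x] dest: LIMSEQ_unique)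
qed

section \<open>Schwartz functions\<close>

lemma nth_vderiv_0 [simp]: "nth_vderiv 0 f = f"
  by (simp add: nth_vderiv_def)

lemma nth_vderiv_add: "nth_vderiv (m + n) f = nth_vderiv m (nth_vderiv n f)"
  by (simp add: nth_vderiv_def funpow_add)

lemma nth_vderiv_schwartz: "f \<in> schwartz \<Longrightarrow> nth_vderiv n f \<in> schwartz"
  by (simp add: schwartz_def flip: nth_vderiv_add)

lemma schwartz_has_vector_derivative:
  assumes "f \<in> schwartz"
  shows "(f has_vector_derivative nth_vderiv 1 f x) (at x)"
proof -
  have "nth_vderiv 0 f differentiable (at x)"
    using assms unfolding schwartz_def by blast
  then show ?thesis
    by (simp add: vector_derivative_works) (simp add: nth_vderiv_def)
qed

lemma schwartz_isCont: "f \<in> schwartz \<Longrightarrow> isCont f x"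
  using schwartz_has_vector_derivative has_vector_derivative_continuous by blast

lemma schwartz_rapidly_decreasing:
  assumes "f \<in> schwartz"
  shows "rapidly_decreasing f"
  unfolding rapidly_decreasing_def
proof (intro conjI allI)
  show "f \<in> borel_measurable borel"
    using schwartz_isCont[OF assms]
    by (intro borel_measurable_continuous_onI continuous_at_imp_continuous_on) simp
  fix m
  have "bounded (range (\<lambda>x. x ^ m *\<^sub>R nth_vderiv 0 f x))"
    using assms unfolding schwartz_def by blast
  then obtain C where "\<And>x. norm (x ^ m *\<^sub>R f x) \<le> C"
    by (auto simp: bounded_iff)
  then show "\<exists>C. \<forall>x. \<bar>x\<bar> ^ m * norm (f x) \<le> C"
    by (auto simp: power_abs)
qed

lemma fourier_nth_vderiv:
  assumes "f \<in> schwartz"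
  shows "fourier (nth_vderiv n f) y = (2 * pi * \<i> * y) ^ n * fourier f y"
proof (induction n)
  case (Suc n)
  let ?g = "nth_vderiv n f"
  have g_schwartz: "?g \<in> schwartz" and deriv_g_schwartz: "nth_vderiv 1 ?g \<in> schwartz"
    using assms by (intro nth_vderiv_schwartz; assumption)+
  have "fourier (nth_vderiv 1 ?g) y = 2 * pi * \<i> * y * fourier ?g y"
    using schwartz_rapidly_decreasing[OF g_schwartz] schwartz_rapidly_decreasing[OF deriv_g_schwartz]
    by (intro fourier_vector_derivative schwartz_has_vector_derivative[OF g_schwartz]
        schwartz_isCont[OF deriv_g_schwartz] rapidly_decreasing_integrable rapidly_decreasing_tendsto_0)
  then show ?case
    by (simp add: Suc flip: nth_vderiv_add)
qed simp

lemma fourier_schwartz_rapidly_decreasing: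
  assumes "f \<in> schwartz"
  shows "rapidly_decreasing (fourier f)"
  unfolding rapidly_decreasing_def
proof (intro conjI allI)
  show "fourier f \<in> borel_measurable borel"
    using assms by (intro fourier_measurable rapidly_decreasing_measurable schwartz_rapidly_decreasing)
  fix m
  have "\<bar>y\<bar> ^ m * norm (fourier f y) \<le> (LBINT x. norm (nth_vderiv m f x))" for y
  proof -
    have "\<bar>y\<bar> \<le> norm (2 * pi * \<i> * y)"
      using pi_gt3 by (simp add: norm_mult mult_le_cancel_right1)
    then have "\<bar>y\<bar> ^ m * norm (fourier f y) \<le> norm (2 * pi * \<i> * y) ^ m * norm (fourier f y)"
      by (intro mult_right_mono power_mono) auto
    also have "\<dots> = norm (fourier (nth_vderiv m f) y)"
      by (simp add: fourier_nth_vderiv[OF assms] norm_mult norm_power)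
    also have "\<dots> \<le> (LBINT x. norm (nth_vderiv m f x))"
      by (rule norm_fourier_le)
    finally show ?thesis .
  qed
  then show "\<exists>C. \<forall>y. \<bar>y\<bar> ^ m * norm (fourier f y) \<le> C"
    by blast
qed

lemma fourier_fourier_schwartz:
  assumes "f \<in> schwartz"
  shows "fourier (fourier f) = (\<lambda>x. f (- x))"
proof
  fix x
  obtain B where bounded: "\<And>x. \<bar>x\<bar> ^ 0 * norm (f x) \<le> B"
    using rapidly_decreasing_bound[OF schwartz_rapidly_decreasing[OF assms]] by blast
  show "fourier (fourier f) x = f (- x)"
  proof (rule fourier_inversion)
    show "integrable lborel f" "integrable lborel (fourier f)"
      by (intro rapidly_decreasing_integrable schwartz_rapidly_decreasing[OF assms]
          fourier_schwartz_rapidly_decreasing[OF assms])+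
  qed (use bounded schwartz_isCont[OF assms] in auto)
qed

theorem theorem4p3:
  fixes a c :: real and f :: "real \<Rightarrow> complex"
  assumes "f \<in> schwartz"
  shows
    "(\<forall>k\<in>{0,1}. (\<lambda>s. Fk k f s a c) meromorphic_on UNIV) \<and>
     ((\<lambda>s. Fk 1 f s a c) holomorphic_on UNIV \<and>
      (a \<notin> \<int> \<and> c \<notin> \<int> \<longrightarrow> (\<lambda>s. Fk 0 f s a c) holomorphic_on UNIV) \<and>
      (\<lambda>s. Fk 0 f s a c) holomorphic_on (UNIV - {0, 1}) \<and>
      (\<forall>p\<in>{0, 1}. is_pole (\<lambda>s. Fk 0 f s a c) p \<longrightarrow> zorder (\<lambda>s. Fk 0 f s a c) p = -1) \<and>
      (is_pole (\<lambda>s. Fk 0 f s a c) 0 \<longrightarrow> c \<in> \<int>) \<and>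
      (is_pole (\<lambda>s. Fk 0 f s a c) 1 \<longrightarrow> a \<in> \<int>) \<and>
      (c \<notin> \<int> \<longrightarrow> (\<lambda>s. Fk 0 f s a c) analytic_on {0}) \<and>
      (a \<notin> \<int> \<longrightarrow> (\<lambda>s. Fk 0 f s a c) analytic_on {1}) \<and>
      (c \<in> \<int> \<longrightarrow>
         residue (\<lambda>s. Fk 0 f s a c) 0 = - 2 * exp (- of_real pi * \<i> * of_real (a * c)) * f 0) \<and>
      (a \<in> \<int> \<longrightarrow>
         residue (\<lambda>s. Fk 0 f s a c) 1 = 2 * exp (of_real pi * \<i> * of_real (a * c)) * fourier f 0)) \<and>
     (\<forall>k\<in>{0,1}. \<forall>s.
        Fk k f s (a + 1) c = exp (of_real pi * \<i> * of_real c) * Fk k f s a c \<and>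
        Fk k f s a (c + 1) = exp (- of_real pi * \<i> * of_real a) * Fk k f s a c) \<and>
     (\<forall>k\<in>{0,1}. \<forall>s.
        Fk k f s a c =
          (-1) ^ k * exp (- of_real pi * \<i> * of_real a) * Fk k (fourier f) (1 - s) (1 - c) a)"
proof -
  let ?F = "\<lambda>k s. Fk k f s a c"
  note rapid = schwartz_rapidly_decreasing[OF assms] fourier_schwartz_rapidly_decreasing[OF assms]
  have "?F k meromorphic_on UNIV" for k
    using rapid by (rule Fk_meromorphic)
  moreover have "?F 1 holomorphic_on UNIV"
    using rapid by (rule Fk_holomorphic) simp
  moreover have "?F 0 holomorphic_on UNIV" if "a \<notin> \<int> \<and> c \<notin> \<int>"
    using rapid by (rule Fk_holomorphic) (use that in simp)
  moreover have "?F 0 holomorphic_on UNIV - {0, 1}"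
    using rapid by (rule Fk_holomorphic_off_poles)
  moreover have "\<forall>p\<in>{0, 1}. is_pole (?F 0) p \<longrightarrow> zorder (?F 0) p = - 1"
    using zorder_Fk_pole_0[OF rapid] zorder_Fk_pole_1[OF rapid] by simp
  moreover have "?F 0 analytic_on {0} \<and> \<not> is_pole (?F 0) 0" if "c \<notin> \<int>"
    using Fk_analytic_at_0[OF rapid that] analytic_at_imp_no_pole by blast
  moreover have "?F 0 analytic_on {1} \<and> \<not> is_pole (?F 0) 1" if "a \<notin> \<int>"
    using Fk_analytic_at_1[OF rapid that] analytic_at_imp_no_pole by blast
  moreover have "residue (?F 0) 0 = - 2 * cis_pi (- (a * c)) * f 0" if "c \<in> \<int>"
    using residue_Fk_0[OF rapid] that by (simp add: Fk_residue_0_def delta_Z_def)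
  moreover have "residue (?F 0) 1 = 2 * cis_pi (a * c) * fourier f 0" if "a \<in> \<int>"
    using residue_Fk_1[OF rapid] that by (simp add: Fk_residue_1_def delta_Z_def)
  ultimately show ?thesis
    unfolding exp_eq_cis_pi
    using Fk_shift_left Fk_shift_right Fk_functional_equation[OF fourier_fourier_schwartz[OF assms]]
    by blast
qed

end
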